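(* Let $(B,\mathbf{C}^t_B)$ be a tangled closure algebra whose induced closure algebra $(B,\mathbf{C}_B)$ is totally disconnected and dissectable, and let $\alpha$ be any non-zero open element of $(B,\mathbf{C}_B)$. Then every finite tangled closure algebra $(A,\mathbf{C}^t_A)$ is isomorphic to a subalgebra of the relativised algebra $(B_\alpha,\mathbf{C}^t_\alpha)$; i.e. there is an injective Boolean homomorphism $f:A\to B_\alpha$ with $f(\mathbf{C}^t_A\varGamma)=\mathbf{C}^t_\alpha\{f\gamma:\gamma\in\varGamma\}$ for all finite non-empty $\varGamma\subseteq A$.
   Context: A Boolean algebra $A$ has operations $\land,\lor,-,0,1$; $a\Rightarrow b=-a\lor b$. A closure operator on $A$ is $\mathbf{C}:A\to A$ with $\mathbf{C}(a\lor b)=\mathbf{C}a\lor\mathbf{C}b$, $\mathbf{C}0=0$, $a\leq\mathbf{C}a=\mathbf{C}\mathbf{C}a$; interior $\mathbf{I}a=-\mathbf{C}-a$; $a$ is open if $\mathbf{I}a=a$. For $\mathbf{C}^t$ from finite non-empty subsets of $A$ to $A$, the induced $\mathbf{C}a=\mathbf{C}^t\{a\}$, $\mathbf{I}a=-\mathbf{C}^t\{-a\}$; $(A,\mathbf{C}^t)$ is a tangled closure algebra if $\mathbf{C}$ is a closure operator and for all finite non-empty $\varGamma\subseteq A$ and $a\in A$: (Fix) $\mathbf{C}^t\varGamma\leq\bigwedge_{\gamma\in\varGamma}\mathbf{C}(\gamma\land\mathbf{C}^t\varGamma)$; (Ind) $\mathbf{I}(a\Rightarrow\bigwedge_{\gamma\in\varGamma}\mathbf{C}(\gamma\land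 a))\land a\leq\mathbf{C}^t\varGamma$. Relativisation to $\alpha\in B$: $B_\alpha=\{b\in B:b\leq\alpha\}$ with the same joins and meets, top $\alpha$, complement $b\mapsto\alpha\land-b$; $\mathbf{C}_\alpha b=\alpha\land\mathbf{C}_Bb$; $\mathbf{C}^t_\alpha\varGamma=\alpha\land\mathbf{C}^t_B\varGamma$. A closure algebra $(B,\mathbf{C}_B)$ is dissectable if for every non-zero open $\alpha\in B$ and all natural numbers $r,s$ there exist non-zero $\alpha_1,\dots,\alpha_r,\beta_1,\dots,\beta_s\in B$ which are pairwise disjoint with join $\alpha$, such that $\alpha_1,\dots,\alpha_r$ are open, and for all $1\le i\leq r$, $1\le j\leq s$: $\mathbf{C}_B\alpha_i\land-\alpha_i=\mathbf{C}_B\beta_j=\mathbf{C}_B\alpha\land-(\alpha_1\lor\cdots\lor\alpha_r)$ (for $r=0$ the sequence of $\alpha_i$ is empty). It is totally disconnected if every non-zero open element is the join of two disjoint non-zero open elements. *)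

theory Defs
  imports Main
begin

unbundle lattice_syntax

definition closure_operator :: "('a::boolean_algebra \<Rightarrow> 'a) \<Rightarrow> bool" where
  "closure_operator C \<longleftrightarrow>
     (\<forall>a b. C (a \<squnion> b) = C a \<squnion> C b) \<and> C \<bottom> = \<bottom> \<and> (\<forall>a. a \<le> C a \<and> C a = C (C a))"

definition interior_op :: "('a::boolean_algebra \<Rightarrow> 'a) \<Rightarrow> 'a \<Rightarrow> 'a" where
  "interior_op C a = - C (- a)"

definition open_element :: "('a::boolean_algebra \<Rightarrow> 'a) \<Rightarrow> 'a \<Rightarrow> bool" where
  "open_element C a \<longleftrightarrow> interior_op C a = a"

definition bimp :: "'a::boolean_algebra \<Rightarrow> 'a \<Rightarrow> 'a" where
  "bimp a b = - a \<squnion> b"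

definition induced_closure :: "('a::boolean_algebra set \<Rightarrow> 'a) \<Rightarrow> 'a \<Rightarrow> 'a" where
  "induced_closure Ct a = Ct {a}"

text \<open>A tangled closure operation is only meaningful on finite non-empty sets; it is represented by
  a total function whose values on other sets are unconstrained and never used.\<close>

definition tangled_closure_algebra :: "('a::boolean_algebra set \<Rightarrow> 'a) \<Rightarrow> bool" where
  "tangled_closure_algebra Ct \<longleftrightarrow>
     closure_operator (induced_closure Ct) \<and>
     (\<forall>\<Gamma>. finite \<Gamma> \<and> \<Gamma> \<noteq> {} \<longrightarrow>
        Ct \<Gamma> \<le> Inf_fin ((\<lambda>\<gamma>. induced_closure Ct (\<gamma> \<sqinter> Ct \<Gamma>)) ` \<Gamma>)) \<and>
     (\<forall>\<Gamma> a. finite \<Gamma> \<and> \<Gamma> \<noteq> {} \<longrightarrow>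
        interior_op (induced_closure Ct)
          (bimp a (Inf_fin ((\<lambda>\<gamma>. induced_closure Ct (\<gamma> \<sqinter> a)) ` \<Gamma>))) \<sqinter> a \<le> Ct \<Gamma>)"

definition list_join :: "'a::boolean_algebra list \<Rightarrow> 'a" where
  "list_join xs = foldr (\<squnion>) xs \<bottom>"

text \<open>The elements \<open>\<alpha>\<^sub>1, \<dots>, \<alpha>\<^sub>r\<close> and \<open>\<beta>\<^sub>1, \<dots>, \<beta>\<^sub>s\<close> are the entries of the lists \<open>as\<close> and \<open>bs\<close>;
  since disjointness is symmetric, \<open>sorted_wrt\<close> expresses disjointness of any two entries at
  different positions. The number \<open>s\<close> is positive: for \<open>r = s = 0\<close> a non-zero \<open>\<alpha>\<close> would have to be
  the empty join. The conditions on the \<open>\<alpha>\<^sub>i\<close> and on the \<open>\<beta>\<^sub>j\<close> are separate quantifications, so that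
  for \<open>r = 0\<close> the requirement \<open>C \<beta>\<^sub>j = C \<alpha>\<close> remains.\<close>

definition dissectable :: "('a::boolean_algebra \<Rightarrow> 'a) \<Rightarrow> bool" where
  "dissectable C \<longleftrightarrow>
     (\<forall>\<alpha> (r::nat) (s::nat). open_element C \<alpha> \<and> \<alpha> \<noteq> \<bottom> \<and> s \<ge> 1 \<longrightarrow>
        (\<exists>as bs. length as = r \<and> length bs = s \<and>
           (\<forall>x \<in> set (as @ bs). x \<noteq> \<bottom>) \<and>
           sorted_wrt (\<lambda>x y. x \<sqinter> y = \<bottom>) (as @ bs) \<and>
           list_join (as @ bs) = \<alpha> \<and>
           (\<forall>a \<in> set as. open_element C a) \<and>
           (\<forall>a \<in> set as. C a \<sqinter> - a = C \<alpha> \<sqinter> - list_join as) \<and>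
           (\<forall>b \<in> set bs. C b = C \<alpha> \<sqinter> - list_join as)))"

definition totally_disconnected :: "('a::boolean_algebra \<Rightarrow> 'a) \<Rightarrow> bool" where
  "totally_disconnected C \<longleftrightarrow>
     (\<forall>\<alpha>. open_element C \<alpha> \<and> \<alpha> \<noteq> \<bottom> \<longrightarrow>
        (\<exists>a b. open_element C a \<and> open_element C b \<and> a \<noteq> \<bottom> \<and> b \<noteq> \<bottom> \<and>
               a \<sqinter> b = \<bottom> \<and> a \<squnion> b = \<alpha>))"

definition rel_carrier :: "'b::boolean_algebra \<Rightarrow> 'b set" where
  "rel_carrier \<alpha> = {b. b \<le> \<alpha>}"

definition rel_compl :: "'b::boolean_algebra \<Rightarrow> 'b \<Rightarrow> 'b" where
  "rel_compl \<alpha> b = \<alpha> \<sqinter> - b"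

definition rel_tangle :: "'b::boolean_algebra \<Rightarrow> ('b set \<Rightarrow> 'b) \<Rightarrow> 'b set \<Rightarrow> 'b" where
  "rel_tangle \<alpha> Ct \<Gamma> = \<alpha> \<sqinter> Ct \<Gamma>"

definition boolean_hom_rel :: "('a::boolean_algebra \<Rightarrow> 'b::boolean_algebra) \<Rightarrow> 'b \<Rightarrow> bool" where
  "boolean_hom_rel f \<alpha> \<longleftrightarrow>
     range f \<subseteq> rel_carrier \<alpha> \<and>
     (\<forall>x y. f (x \<squnion> y) = f x \<squnion> f y) \<and>
     (\<forall>x y. f (x \<sqinter> y) = f x \<sqinter> f y) \<and>
     (\<forall>x. f (- x) = rel_compl \<alpha> (f x)) \<and>
     f \<bottom> = \<bottom> \<and> f \<top> = \<alpha>"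

end

theory Submission
  imports Defs
begin

text \<open>A tangled closure is the greatest \<open>a\<close> with \<open>a \<le> C (\<gamma> \<sqinter> a)\<close> for all \<open>\<gamma> \<in> \<Gamma>\<close>, so
  it is determined by \<open>C\<close>, and every embedding of the closure algebra of a finite \<open>A\<close> preserves it:
  if \<open>b\<close> is the tangled closure of the image of \<open>\<Gamma>\<close>, then the least \<open>a\<close> with \<open>b \<le> f a\<close> is
  again such a post-fixed point, hence below the tangled closure of \<open>\<Gamma>\<close>.

  The closure embedding is a map \<open>g\<close> from the atoms of \<open>A\<close>, preordered by \<open>w \<le> C v\<close>, to a partition
  of \<open>\<alpha>\<close>. For the up-set of one atom \<open>x\<close> it is built by induction: dissect \<open>\<alpha>\<close> with one \<open>\<beta>\<close> for
  each element of the cluster of \<open>x\<close> and one open \<open>\<alpha>\<^sub>t\<close> for each \<open>t\<close> strictly above \<open>x\<close>, and use the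
  maps for the up-sets of the \<open>t\<close> inside the \<open>\<alpha>\<^sub>t\<close>. To make the \<open>\<beta>\<close>s lie in the closure of all
  pieces above them, the induction also provides that the closure of each piece contains
  the boundary \<open>C \<alpha> \<sqinter> - \<alpha>\<close>. Total disconnectedness splits \<open>\<alpha>\<close> into one open part for each atom.\<close>

section \<open>Finite joins\<close>

text \<open>\<open>Sup_fin\<close> is specified only on non-empty sets; the inserted
  \<open>\<bottom>\<close> gives the empty family its join. The algebra need not be complete, so
  only finite joins are available.\<close>

definition finjoin :: "('i \<Rightarrow> 'b::boolean_algebra) \<Rightarrow> 'i set \<Rightarrow> 'b" where
  "finjoin f S = Sup_fin (insert \<bottom> (f ` S))"

lemma finjoin_le_iff: "finite S \<Longrightarrow> finjoin f S \<le> c \<longleftrightarrow> (\<forall>x\<in>S. f x \<le> c)"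
  unfolding finjoin_def by (subst Sup_fin.bounded_iff) auto

lemma finjoin_upper: "finite S \<Longrightarrow> x \<in> S \<Longrightarrow> f x \<le> finjoin f S"
  using finjoin_le_iff[of S f "finjoin f S"] by auto

text \<open>A join is determined by its upper bounds, so identities between joins reduce to
  equivalences of bounds.\<close>

lemma finjoin_eqI:
  assumes "finite S" and "\<And>c. (\<forall>x\<in>S. f x \<le> c) \<longleftrightarrow> b \<le> c"
  shows "finjoin f S = b"
  using assms by (metis finjoin_le_iff order.antisym order.refl)

lemma finjoin_empty [simp]: "finjoin f {} = \<bottom>"
  by (simp add: finjoin_def)

lemma finjoin_insert: "finite S \<Longrightarrow> finjoin f (insert x S) = f x \<squnion> finjoin f S"
  by (rule finjoin_eqI) (auto simp: finjoin_le_iff)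

lemma finjoin_Un: "finite S \<Longrightarrow> finite T \<Longrightarrow> finjoin f (S \<union> T) = finjoin f S \<squnion> finjoin f T"
  by (rule finjoin_eqI) (auto simp: finjoin_le_iff)

lemma disjoint_finjoin_iff: "finite S \<Longrightarrow> finjoin f S \<sqinter> c = \<bottom> \<longleftrightarrow> (\<forall>x\<in>S. f x \<sqinter> c = \<bottom>)"
  by (simp add: inf_shunt finjoin_le_iff)

lemma disjoint_finjoin_iff': "finite S \<Longrightarrow> c \<sqinter> finjoin f S = \<bottom> \<longleftrightarrow> (\<forall>x\<in>S. c \<sqinter> f x = \<bottom>)"
  using disjoint_finjoin_iff[of S f c] by (simp add: inf_commute)

lemma finjoin_eq_bot_iff: "finite S \<Longrightarrow> finjoin f S = \<bottom> \<longleftrightarrow> (\<forall>x\<in>S. f x = \<bottom>)"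
  using finjoin_le_iff[of S f "\<bottom>"] by (simp add: bot_unique)

lemma list_join_le_iff: "list_join xs \<le> c \<longleftrightarrow> (\<forall>x\<in>set xs. x \<le> c)"
  by (induction xs) (auto simp: list_join_def)

section \<open>Realizing preorders by partitions\<close>

text \<open>Such pieces act as the fibres of an interior map from \<open>\<alpha>\<close> onto
  \<open>U\<close> with the up-set topology of \<open>R\<close>. The index type may be infinite, so
  the third clause describes the join \<open>\<alpha>\<close> by its upper bounds. Indices outside
  \<open>U\<close> get \<open>\<bottom>\<close>; for a closure operator the last clause therefore
  forces \<open>U\<close> to be closed upwards under \<open>R\<close>.\<close>

definition realizes ::
  "('b::boolean_algebra \<Rightarrow> 'b) \<Rightarrow> ('w \<Rightarrow> 'w \<Rightarrow> bool) \<Rightarrow> 'w set \<Rightarrow> 'b \<Rightarrow> ('w \<Rightarrow> 'b) \<Rightarrow> bool" where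
  "realizes C R U \<alpha> g \<longleftrightarrow>
     (\<forall>y. g y \<noteq> \<bottom> \<longleftrightarrow> y \<in> U) \<and>
     (\<forall>y z. y \<noteq> z \<longrightarrow> g y \<sqinter> g z = \<bottom>) \<and>
     (\<forall>c. (\<forall>y. g y \<le> c) \<longleftrightarrow> \<alpha> \<le> c) \<and>
     (\<forall>y z. if R z y then g z \<le> C (g y) else g z \<sqinter> C (g y) = \<bottom>)"

section \<open>Closure operators, joins and open elements\<close>

context
  fixes C :: "'b::boolean_algebra \<Rightarrow> 'b"
  assumes C: "closure_operator C"
begin

lemma closure_sup: "C (a \<squnion> b) = C a \<squnion> C b"
  using C by (simp add: closure_operator_def)

lemma closure_bot: "C \<bottom> = \<bottom>"
  using C by (simp add: closure_operator_def)

lemma closure_increasing: "a \<le> C a"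
  using C by (simp add: closure_operator_def)

lemma closure_idem: "C (C a) = C a"
  using C by (simp add: closure_operator_def)

lemma closure_mono: "a \<le> b \<Longrightarrow> C a \<le> C b"
  by (metis closure_sup le_iff_sup)

lemma closure_finjoin: "finite S \<Longrightarrow> C (finjoin f S) = finjoin (\<lambda>x. C (f x)) S"
  by (induction S rule: finite_induct) (simp_all add: finjoin_insert closure_sup closure_bot)

text \<open>The complement of an open element is closed, so it contains the closure of everything
  below it.\<close>

lemma open_disjoint_closure:
  assumes "open_element C a" and "a \<sqinter> b = \<bottom>"
  shows "a \<sqinter> C b = \<bottom>"
proof -
  have eq: "C (- a) = - a"
    using assms(1) by (metis open_element_def interior_op_def double_compl)
  have "b \<le> - a"
    using assms(2) by (metis inf_shunt inf_commute)
  then have "C b \<le> - a"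
    using closure_mono eq by metis
  then show ?thesis
    by (metis inf_shunt inf_commute)
qed

section \<open>Dissections and open splittings indexed by finite sets\<close>

text \<open>Moves a dissection from lists to families, so that its pieces can be indexed by the
  points of a preorder. Bijections with initial segments of the naturals do the transport, and a
  non-empty \<open>K\<close> supplies \<open>s \<ge> 1\<close>.\<close>

lemma dissectable_indexed:
  fixes T K :: "'i set"
  assumes "dissectable C" and "open_element C \<alpha>" and "\<alpha> \<noteq> \<bottom>"
    and T: "finite T" and K: "finite K" and "K \<noteq> {}"
  obtains a b where
    "\<And>t. t \<in> T \<Longrightarrow> a t \<noteq> \<bottom>" "\<And>t. t \<in> T \<Longrightarrow> open_element C (a t)"
    "\<And>t u. t \<in> T \<Longrightarrow> u \<in> T \<Longrightarrow> t \<noteq> u \<Longrightarrow> a t \<sqinter> a u = \<bottom>"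
    "\<And>k. k \<in> K \<Longrightarrow> b k \<noteq> \<bottom>"
    "\<And>k l. k \<in> K \<Longrightarrow> l \<in> K \<Longrightarrow> k \<noteq> l \<Longrightarrow> b k \<sqinter> b l = \<bottom>"
    "finjoin a T \<squnion> finjoin b K = \<alpha>"
    "\<And>t. t \<in> T \<Longrightarrow> C (a t) \<sqinter> - a t = C \<alpha> \<sqinter> - finjoin a T"
    "\<And>k. k \<in> K \<Longrightarrow> C (b k) = C \<alpha> \<sqinter> - finjoin a T"
proof -
  have "open_element C \<alpha> \<and> \<alpha> \<noteq> \<bottom> \<and> card K \<ge> 1"
    using assms(2,3) K \<open>K \<noteq> {}\<close> by (simp add: Suc_leI card_gt_0_iff)
  from assms(1)[unfolded dissectable_def, THEN spec, THEN spec[of _ "card T"], THEN spec, THEN mp, OF this]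
  obtain as bs where len: "length as = card T" "length bs = card K"
    and nz: "\<forall>x \<in> set (as @ bs). x \<noteq> \<bottom>"
    and disj: "sorted_wrt (\<lambda>x y. x \<sqinter> y = \<bottom>) (as @ bs)"
    and join: "list_join (as @ bs) = \<alpha>"
    and op: "\<forall>a \<in> set as. open_element C a"
    and bda: "\<forall>a \<in> set as. C a \<sqinter> - a = C \<alpha> \<sqinter> - list_join as"
    and bdb: "\<forall>b \<in> set bs. C b = C \<alpha> \<sqinter> - list_join as"
    by (elim exE conjE)
  obtain h where h: "bij_betw h T {0..<card T}"
    using T ex_bij_betw_finite_nat by blast
  obtain m where m: "bij_betw m K {0..<card K}"
    using K ex_bij_betw_finite_nat by blast
  define a where "a t = as ! h t" for t
  define b where "b k = bs ! m k" for k
  have nth_img: "set xs = (\<lambda>t. xs ! p t) ` S" if "bij_betw p S {0..<length xs}"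
    for xs :: "'b list" and p and S :: "'i set"
  proof -
    have "(\<lambda>t. xs ! p t) ` S = (!) xs ` {0..<length xs}"
      using that by (simp add: bij_betw_def image_image flip: that[THEN bij_betw_imp_surj_on])
    also have "\<dots> = set xs"
      by (auto simp: set_conv_nth)
    finally show ?thesis ..
  qed
  have a_img: "set as = a ` T"
    using nth_img h len unfolding a_def by metis
  have b_img: "set bs = b ` K"
    using nth_img m len unfolding b_def by metis
  \<comment> \<open>\<open>sorted_wrt\<close> speaks only of increasing positions; commutativity of
    the meet covers the other order.\<close>
  have nth_disj: "xs ! i \<sqinter> xs ! j = \<bottom>"
    if "sorted_wrt (\<lambda>x y. x \<sqinter> y = \<bottom>) xs" "i < length xs" "j < length xs" "i \<noteq> j"
    for xs :: "'b list" and i j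
  proof (cases i j rule: linorder_cases)
    case less
    then show ?thesis using that sorted_wrt_nth_less by fastforce
  next
    case equal
    then show ?thesis using that(4) by simp
  next
    case greater
    then have "xs ! j \<sqinter> xs ! i = \<bottom>" using that sorted_wrt_nth_less by fastforce
    then show ?thesis by (simp add: inf_commute)
  qed
  have ja: "finjoin a T = list_join as"
    by (rule finjoin_eqI[OF T]) (simp add: list_join_le_iff a_img)
  have jb: "finjoin b K = list_join bs"
    by (rule finjoin_eqI[OF K]) (simp add: list_join_le_iff b_img)
  have jab: "list_join (as @ bs) = list_join as \<squnion> list_join bs"
    by (induction as) (simp_all add: list_join_def sup_assoc)
  show ?thesis
  proof (rule that[of a b])
    show "a t \<sqinter> a u = \<bottom>" if "t \<in> T" "u \<in> T" "t \<noteq> u" for t u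
    proof -
      have "h t < length as" "h u < length as" "h t \<noteq> h u"
        using that h len by (auto simp: bij_betw_def inj_on_def)
      then show ?thesis
        using nth_disj disj by (simp add: a_def sorted_wrt_append)
    qed
    show "b k \<sqinter> b l = \<bottom>" if "k \<in> K" "l \<in> K" "k \<noteq> l" for k l
    proof -
      have "m k < length bs" "m l < length bs" "m k \<noteq> m l"
        using that m len by (auto simp: bij_betw_def inj_on_def)
      then show ?thesis
        using nth_disj disj by (simp add: b_def sorted_wrt_append)
    qed
    show "finjoin a T \<squnion> finjoin b K = \<alpha>"
      using ja jb jab join by simp
  qed (use nz op bda bdb ja a_img b_img in auto)
qed

text \<open>Induction on the index set: split once, give one half to the new index and distribute
  the other half over the old ones.\<close>

lemma totally_disconnected_indexed:
  assumes "totally_disconnected C" and "finite T" and "T \<noteq> {}"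
    and "open_element C \<alpha>" and "\<alpha> \<noteq> \<bottom>"
  shows "\<exists>a. (\<forall>t\<in>T. open_element C (a t) \<and> a t \<noteq> \<bottom>) \<and>
           (\<forall>t\<in>T. \<forall>u\<in>T. t \<noteq> u \<longrightarrow> a t \<sqinter> a u = \<bottom>) \<and> finjoin a T = \<alpha>"
  using assms(2-)
proof (induction T arbitrary: \<alpha> rule: finite_ne_induct)
  case (singleton x)
  then show ?case
    by (intro exI[of _ "\<lambda>_. \<alpha>"]) (simp add: finjoin_insert)
next
  case (insert x T)
  obtain c d where cd: "open_element C c" "open_element C d" "c \<noteq> \<bottom>" "d \<noteq> \<bottom>"
    "c \<sqinter> d = \<bottom>" "c \<squnion> d = \<alpha>"
    using assms(1) insert.prems unfolding totally_disconnected_def by metis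
  obtain a where a: "\<forall>t\<in>T. open_element C (a t) \<and> a t \<noteq> \<bottom>"
    "\<forall>t\<in>T. \<forall>u\<in>T. t \<noteq> u \<longrightarrow> a t \<sqinter> a u = \<bottom>" "finjoin a T = d"
    using insert.IH[of d] cd by blast
  have ac: "a t \<sqinter> c = \<bottom>" if "t \<in> T" for t
    using disjoint_finjoin_iff[OF insert.hyps(1), of a c] a(3) cd(5) that by (simp add: inf_commute)
  have join: "finjoin (a(x := c)) T = d"
    using insert.hyps a(3) by (intro finjoin_eqI) (auto simp: finjoin_le_iff)
  have "finjoin (a(x := c)) (insert x T) = \<alpha>"
    using insert.hyps(1) join cd(6) by (simp add: finjoin_insert)
  moreover have "\<forall>t\<in>insert x T. open_element C ((a(x := c)) t) \<and> (a(x := c)) t \<noteq> \<bottom>"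
    using a(1) cd by simp
  moreover have "\<forall>t\<in>insert x T. \<forall>u\<in>insert x T. t \<noteq> u \<longrightarrow> (a(x := c)) t \<sqinter> (a(x := c)) u = \<bottom>"
    using a(2) ac by (auto simp: inf_commute)
  ultimately show ?case by blast
qed

section \<open>Gluing and building realizations\<close>

text \<open>Disjoint open parts miss even each other's closures, so closure relations arise only
  inside a single part, where they already agree with \<open>R\<close>. The sets \<open>V t\<close>
  may overlap: the copies of one point in several parts are simply joined.\<close>

lemma realizes_glue:
  assumes T: "finite T"
    and op: "\<And>t. t \<in> T \<Longrightarrow> open_element C (a t)"
    and disj: "\<And>t u. t \<in> T \<Longrightarrow> u \<in> T \<Longrightarrow> t \<noteq> u \<Longrightarrow> a t \<sqinter> a u = \<bottom>"
    and G: "\<And>t. t \<in> T \<Longrightarrow> realizes C R (V t) (a t) (G t)"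
  shows "realizes C R (\<Union>t\<in>T. V t) (finjoin a T) (\<lambda>y. finjoin (\<lambda>t. G t y) T)"
proof -
  have G_le: "G t y \<le> a t" if "t \<in> T" for t y
    using G[OF that] unfolding realizes_def by blast
  have G_disj: "G t y \<sqinter> G u z = \<bottom>" if "t \<in> T" "u \<in> T" "y \<noteq> z" for t u y z
  proof (cases "t = u")
    case True
    then show ?thesis using G[of t] that unfolding realizes_def by blast
  next
    case False
    then have "a t \<sqinter> a u = \<bottom>" using disj that by blast
    then show ?thesis
      using G_le that by (metis inf_mono bot_unique)
  qed
  have G_closure: "G t z \<sqinter> C (G u y) = \<bottom>" if "t \<in> T" "u \<in> T" "\<not> R z y" for t u y z
  proof (cases "t = u")
    case True
    then show ?thesis using G[of t] that unfolding realizes_def by metis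
  next
    case False
    then have "a t \<sqinter> a u = \<bottom>" using disj that by blast
    then have "a t \<sqinter> C (a u) = \<bottom>" using open_disjoint_closure op that by blast
    then show ?thesis
      using G_le closure_mono that by (metis inf_mono bot_unique)
  qed
  let ?g = "\<lambda>y. finjoin (\<lambda>t. G t y) T"
  show ?thesis
    unfolding realizes_def
  proof (intro conjI allI impI)
    show "?g y \<noteq> \<bottom> \<longleftrightarrow> y \<in> (\<Union>t\<in>T. V t)" for y
      using G T unfolding realizes_def by (simp add: finjoin_eq_bot_iff)
    show "?g y \<sqinter> ?g z = \<bottom>" if "y \<noteq> z" for y z
      using T G_disj that by (simp add: disjoint_finjoin_iff disjoint_finjoin_iff')
    show "(\<forall>y. ?g y \<le> c) \<longleftrightarrow> finjoin a T \<le> c" for c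
      using G T unfolding realizes_def by (simp add: finjoin_le_iff) blast
    show "if R z y then ?g z \<le> C (?g y) else ?g z \<sqinter> C (?g y) = \<bottom>" for y z
    proof (cases "R z y")
      case True
      have "G t z \<le> C (?g y)" if "t \<in> T" for t
      proof -
        have "G t z \<le> C (G t y)"
          using G[OF that] True unfolding realizes_def by metis
        also have "\<dots> \<le> C (?g y)"
          using closure_mono finjoin_upper[OF T that, of "\<lambda>t. G t y"] by blast
        finally show ?thesis .
      qed
      then show ?thesis using True T by (simp add: finjoin_le_iff)
    next
      case False
      have "G t z \<sqinter> finjoin (\<lambda>t. C (G t y)) T = \<bottom>" if "t \<in> T" for t
        using T G_closure that False by (simp add: disjoint_finjoin_iff')
      then show ?thesis using False T by (simp add: disjoint_finjoin_iff closure_finjoin)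
    qed
  qed
qed

lemma realizes_rooted:
  assumes dis: "dissectable C"
    and refl: "\<And>x. R x x" and trans: "\<And>x y z. R x y \<Longrightarrow> R y z \<Longrightarrow> R x z"
    and "finite {y. R x y}" and "open_element C \<alpha>" and "\<alpha> \<noteq> \<bottom>"
  shows "\<exists>g. realizes C R {y. R x y} \<alpha> g \<and> (\<forall>y. R x y \<longrightarrow> C \<alpha> \<sqinter> - \<alpha> \<le> C (g y))"
  using assms(4-6)
proof (induction "card {y. R x y}" arbitrary: x \<alpha> rule: less_induct)
  case less
  define K where "K = {y. R x y \<and> R y x}"
  define T where "T = {y. R x y \<and> \<not> R y x}"
  have fin: "finite K" "finite T"
    using less.prems(1) by (auto simp: K_def T_def intro: finite_subset)
  have "K \<noteq> {}"
    using refl by (auto simp: K_def)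
  obtain a b where a_nz: "\<And>t. t \<in> T \<Longrightarrow> a t \<noteq> \<bottom>" and a_op: "\<And>t. t \<in> T \<Longrightarrow> open_element C (a t)"
    and a_disj: "\<And>t u. t \<in> T \<Longrightarrow> u \<in> T \<Longrightarrow> t \<noteq> u \<Longrightarrow> a t \<sqinter> a u = \<bottom>"
    and b_nz: "\<And>k. k \<in> K \<Longrightarrow> b k \<noteq> \<bottom>"
    and b_disj: "\<And>k l. k \<in> K \<Longrightarrow> l \<in> K \<Longrightarrow> k \<noteq> l \<Longrightarrow> b k \<sqinter> b l = \<bottom>"
    and join: "finjoin a T \<squnion> finjoin b K = \<alpha>"
    and bda: "\<And>t. t \<in> T \<Longrightarrow> C (a t) \<sqinter> - a t = C \<alpha> \<sqinter> - finjoin a T"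
    and bdb: "\<And>k. k \<in> K \<Longrightarrow> C (b k) = C \<alpha> \<sqinter> - finjoin a T"
    using dissectable_indexed[OF dis less.prems(2,3) fin(2,1) \<open>K \<noteq> {}\<close>] by blast
  have "\<exists>g. realizes C R {y. R t y} (a t) g \<and> (\<forall>y. R t y \<longrightarrow> C (a t) \<sqinter> - a t \<le> C (g y))"
    if "t \<in> T" for t
  proof (rule less.hyps)
    \<comment> \<open>The inclusion is strict because \<open>x\<close> lies in its own up-set but
      not in that of \<open>t\<close>.\<close>
    have sub: "{y. R t y} \<subset> {y. R x y}"
      using that refl trans unfolding T_def by blast
    then show "card {y. R t y} < card {y. R x y}"
      using less.prems(1) psubset_card_mono by blast
    show "finite {y. R t y}"
      using sub less.prems(1) finite_subset by blast
  qed (use that a_op a_nz in auto)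
  then obtain G where G: "\<And>t. t \<in> T \<Longrightarrow> realizes C R {y. R t y} (a t) (G t)"
    and G_bd: "\<And>t y. t \<in> T \<Longrightarrow> R t y \<Longrightarrow> C (a t) \<sqinter> - a t \<le> C (G t y)"
    by metis
  \<comment> \<open>\<open>T\<close> holds all points strictly above \<open>x\<close>, so
    \<open>y\<close> may occur in the up-sets of several \<open>t\<close>; its piece collects all
    these copies.\<close>
  define h where "h y = finjoin (\<lambda>t. G t y) T" for y
  have "realizes C R (\<Union>t\<in>T. {y. R t y}) (finjoin a T) (\<lambda>y. finjoin (\<lambda>t. G t y) T)"
    by (rule realizes_glue) (use fin a_op a_disj G in auto)
  \<comment> \<open>By transitivity, a point above one strictly above \<open>x\<close> is itself
    strictly above \<open>x\<close>.\<close>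
  moreover have "(\<Union>t\<in>T. {y. R t y}) = T"
    using refl trans unfolding T_def by blast
  ultimately have h: "realizes C R T (finjoin a T) h"
    by (simp add: h_def[abs_def])
  have h_nz: "h y \<noteq> \<bottom> \<longleftrightarrow> y \<in> T" for y
    using h unfolding realizes_def by blast
  have h_disj: "y \<noteq> z \<Longrightarrow> h y \<sqinter> h z = \<bottom>" for y z
    using h unfolding realizes_def by blast
  have h_lub: "(\<forall>y. h y \<le> c) \<longleftrightarrow> finjoin a T \<le> c" for c
    using h unfolding realizes_def by blast
  have h_closure: "if R z y then h z \<le> C (h y) else h z \<sqinter> C (h y) = \<bottom>" for y z
    using h unfolding realizes_def by blast
  \<comment> \<open>The part of \<open>C \<alpha>\<close> left over by the open pieces is exactly
    the boundary of \<open>a y\<close>, so the inductive boundary clause applies to \<open>y\<close>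
    as the root of its own up-set.\<close>
  have h_bd: "C \<alpha> \<sqinter> - finjoin a T \<le> C (h y)" if "y \<in> T" for y
  proof -
    have "C \<alpha> \<sqinter> - finjoin a T \<le> C (G y y)"
      using G_bd[OF that refl] bda[OF that] by simp
    also have "\<dots> \<le> C (h y)"
      unfolding h_def using closure_mono finjoin_upper[OF fin(2) that, of "\<lambda>t. G t y"] by blast
    finally show ?thesis .
  qed
  \<comment> \<open>Each \<open>h z\<close> lies below the join of the open pieces, which the
    closure of \<open>b k\<close> avoids.\<close>
  have h_closure_b: "h z \<sqinter> C (b k) = \<bottom>" if "k \<in> K" for z k
  proof -
    have "h z \<le> - C (b k)"
      using h_lub[of "finjoin a T"] bdb[OF that] by (simp add: le_supI2)
    then show ?thesis by (simp add: inf_shunt)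
  qed
  have h_b: "h z \<sqinter> b k = \<bottom>" if "k \<in> K" for z k
    using h_closure_b[OF that] closure_increasing by (metis inf_mono order.refl bot_unique)
  define g where "g y = (if y \<in> K then b y else h y)" for y
  have hK: "h k = \<bottom>" if "k \<in> K" for k
    using h_nz that by (auto simp: K_def T_def)
  have "realizes C R {y. R x y} \<alpha> g"
    unfolding realizes_def
  proof (intro conjI allI impI)
    show "g y \<noteq> \<bottom> \<longleftrightarrow> y \<in> {y. R x y}" for y
      using h_nz b_nz by (auto simp: g_def K_def T_def)
    show "g y \<sqinter> g z = \<bottom>" if "y \<noteq> z" for y z
      using that h_disj b_disj h_b by (auto simp: g_def inf_commute)
    show "(\<forall>y. g y \<le> c) \<longleftrightarrow> \<alpha> \<le> c" for c
    proof -
      \<comment> \<open>Overriding \<open>h\<close> on \<open>K\<close> loses nothing, since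
        \<open>h\<close> is \<open>\<bottom>\<close> there.\<close>
      have "(\<forall>y. g y \<le> c) \<longleftrightarrow> (\<forall>y\<in>K. b y \<le> c) \<and> (\<forall>y. h y \<le> c)"
        using hK by (metis g_def bot_least)
      then show ?thesis
        using fin(1) by (simp add: h_lub finjoin_le_iff flip: join) blast
    qed
    show "if R z y then g z \<le> C (g y) else g z \<sqinter> C (g y) = \<bottom>" for y z
    \<comment> \<open>Inside the cluster all \<open>b k\<close> have the same closure. From the
      cluster to a point strictly above it, \<open>h_bd\<close> gives the inclusion; in the reverse
      direction \<open>h_closure_b\<close> gives disjointness. Off the cluster the relation is
      inherited from \<open>h\<close>.\<close>
    proof (cases "z \<in> K"; cases "y \<in> K")
      assume "z \<in> K" "y \<in> K"
      moreover then have "R z y" using trans unfolding K_def by blast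
      ultimately show ?thesis
        using bdb closure_increasing[of "b z"] by (simp add: g_def)
    next
      assume zy: "z \<in> K" "y \<notin> K"
      show ?thesis
      proof (cases "R z y")
        case True
        then have "y \<in> T" using zy trans unfolding K_def T_def by blast
        then show ?thesis
          using order.trans[OF closure_increasing[of "b z"], of "C (h y)"] h_bd bdb[OF zy(1)] True zy
          by (simp add: g_def)
      next
        case False
        then have "y \<notin> T" using zy trans unfolding K_def T_def by blast
        then show ?thesis
          using h_nz[of y] False zy by (simp add: g_def closure_bot)
      qed
    next
      assume zy: "z \<notin> K" "y \<in> K"
      have "z \<notin> T" if "R z y"
        using that zy trans unfolding K_def T_def by blast
      then show ?thesis
        using zy h_nz[of z] h_closure_b by (auto simp: g_def)
    next
      assume "z \<notin> K" "y \<notin> K"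
      then show ?thesis using h_closure by (simp add: g_def)
    qed
  qed
  \<comment> \<open>The boundary clause is re-established: removing only the open pieces from
    \<open>C \<alpha>\<close> leaves at least its boundary, and every piece over the up-set has all
    of that remainder in its closure.\<close>
  moreover have "C \<alpha> \<sqinter> - \<alpha> \<le> C (g y)" if "R x y" for y
  proof -
    have "C \<alpha> \<sqinter> - \<alpha> \<le> C \<alpha> \<sqinter> - finjoin a T"
      using join by (metis inf_mono order.refl compl_mono sup_ge1)
    also have "\<dots> \<le> C (g y)"
      using that h_bd bdb by (auto simp: g_def K_def T_def)
    finally show ?thesis .
  qed
  ultimately show ?case by blast
qed

text \<open>\<open>W\<close> may lack a root, but it is the union of the up-sets of its points. Each
  of these is rooted and is realized in an open part of its own.\<close>

lemma realizes_finite_preorder: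
  assumes "totally_disconnected C" and "dissectable C"
    and refl: "\<And>x. R x x" and trans: "\<And>x y z. R x y \<Longrightarrow> R y z \<Longrightarrow> R x z"
    and W: "finite W" "W \<noteq> {}" and up: "\<And>x y. x \<in> W \<Longrightarrow> R x y \<Longrightarrow> y \<in> W"
    and \<alpha>: "open_element C \<alpha>" "\<alpha> \<noteq> \<bottom>"
  shows "\<exists>g. realizes C R W \<alpha> g"
proof -
  obtain a where a: "\<forall>t\<in>W. open_element C (a t) \<and> a t \<noteq> \<bottom>"
    "\<forall>t\<in>W. \<forall>u\<in>W. t \<noteq> u \<longrightarrow> a t \<sqinter> a u = \<bottom>" "finjoin a W = \<alpha>"
    using totally_disconnected_indexed[OF assms(1) W \<alpha>] by blast
  have "\<exists>g. realizes C R {y. R t y} (a t) g" if "t \<in> W" for t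
  proof -
    have "finite {y. R t y}"
      using W(1) up[OF that] by (auto intro: finite_subset)
    then show ?thesis
      using realizes_rooted[of R t "a t"] assms(2) refl trans a(1) that by blast
  qed
  then obtain G where "\<And>t. t \<in> W \<Longrightarrow> realizes C R {y. R t y} (a t) (G t)"
    by metis
  then have "realizes C R (\<Union>t\<in>W. {y. R t y}) \<alpha> (\<lambda>y. finjoin (\<lambda>t. G t y) W)"
    using realizes_glue[OF W(1), of a R "\<lambda>t. {y. R t y}" G] a by blast
  moreover have "(\<Union>t\<in>W. {y. R t y}) = W"
    using refl up by blast
  ultimately show ?thesis by auto
qed

end

section \<open>Atoms of finite Boolean algebras\<close>

definition atoms :: "'a::boolean_algebra set" where
  "atoms = {w. w \<noteq> \<bottom> \<and> (\<forall>v\<le>w. v = \<bottom> \<or> v = w)}"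

lemma atom_le_or_disjoint: "w \<in> atoms \<Longrightarrow> w \<le> x \<or> w \<sqinter> x = \<bottom>"
  unfolding atoms_def using inf_le1[of w x] by (metis (mono_tags, lifting) inf.orderI mem_Collect_eq)

text \<open>The elements above an atom form an ultrafilter.\<close>

lemma atom_le_compl_iff:
  assumes "w \<in> atoms" shows "w \<le> - x \<longleftrightarrow> \<not> w \<le> x"
proof -
  have "w \<noteq> \<bottom>" using assms by (simp add: atoms_def)
  then show ?thesis
    using atom_le_or_disjoint[OF assms, of x] by (metis inf_shunt inf.absorb1)
qed

lemma atom_le_sup_iff:
  assumes "w \<in> atoms" shows "w \<le> x \<squnion> y \<longleftrightarrow> w \<le> x \<or> w \<le> y"
  using atom_le_compl_iff[OF assms, of "x \<squnion> y"] atom_le_compl_iff[OF assms]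
  by (metis compl_sup le_inf_iff)

lemma atom_le_finjoin_iff:
  assumes "w \<in> atoms" and "finite S"
  shows "w \<le> finjoin f S \<longleftrightarrow> (\<exists>x\<in>S. w \<le> f x)"
  using assms(2,1)
  by (induction S rule: finite_induct)
    (auto simp: finjoin_insert atom_le_sup_iff atoms_def bot_unique)

lemma ex_atom_le:
  fixes x :: "'a::boolean_algebra"
  assumes "finite (UNIV :: 'a set)" and "x \<noteq> \<bottom>"
  obtains w where "w \<in> atoms" "w \<le> x"
proof -
  obtain w where w: "w \<in> {v. v \<noteq> \<bottom>}" "w \<le> x" "\<And>v. v \<in> {v. v \<noteq> \<bottom>} \<Longrightarrow> v \<le> w \<Longrightarrow> w = v"
    using finite_has_minimal2[of "{v. v \<noteq> \<bottom>}" x] assms finite_subset[OF subset_UNIV] by auto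
  then show ?thesis using that[of w] by (auto simp: atoms_def)
qed

text \<open>Otherwise the difference would contain an atom lying both below the join and below its
  complement.\<close>

lemma finjoin_atoms_le:
  fixes x :: "'a::boolean_algebra"
  assumes fin: "finite (UNIV :: 'a set)"
  shows "finjoin (\<lambda>w. w) {w \<in> atoms. w \<le> x} = x"
proof (rule order.antisym)
  have finS: "finite S" for S :: "'a set" by (rule finite_subset[OF subset_UNIV fin])
  let ?j = "finjoin (\<lambda>w. w) {w \<in> atoms. w \<le> x}"
  show "?j \<le> x" using finS by (simp add: finjoin_le_iff)
  show "x \<le> ?j"
  proof (rule ccontr)
    assume "\<not> x \<le> ?j"
    then have "x \<sqinter> - ?j \<noteq> \<bottom>" by (simp add: inf_shunt)
    then obtain w where w: "w \<in> atoms" "w \<le> x \<sqinter> - ?j" using ex_atom_le[OF fin] by blast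
    then have "w \<le> ?j" using finS finjoin_upper[of "{w \<in> atoms. w \<le> x}" w "\<lambda>w. w"] by auto
    then show False using w atom_le_compl_iff by auto
  qed
qed

section \<open>Embeddings\<close>

text \<open>Closure commutes with finite joins and every element is a join of atoms, so
  \<open>CA\<close> is determined by the relation \<open>w \<le> CA v\<close> between atoms. The
  pieces reproduce this relation under \<open>CB\<close>.\<close>

lemma closure_embedding_of_realization:
  fixes CA :: "'a::boolean_algebra \<Rightarrow> 'a" and CB :: "'b::boolean_algebra \<Rightarrow> 'b"
  assumes CA: "closure_operator CA" and CB: "closure_operator CB" and fin: "finite (UNIV :: 'a set)"
    and g: "realizes CB (\<lambda>w v. w \<le> CA v \<and> (w \<in> atoms \<longrightarrow> v \<in> atoms)) atoms \<alpha> g"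
  shows "\<exists>f. boolean_hom_rel f \<alpha> \<and> inj f \<and> (\<forall>x. f (CA x) = \<alpha> \<sqinter> CB (f x))"
proof -
  have finS: "finite S" for S :: "'a set" by (rule finite_subset[OF subset_UNIV fin])
  have g_nz: "g y \<noteq> \<bottom> \<longleftrightarrow> y \<in> atoms" for y
    using g unfolding realizes_def by blast
  have g_disj: "y \<noteq> z \<Longrightarrow> g y \<sqinter> g z = \<bottom>" for y z
    using g unfolding realizes_def by blast
  have g_lub: "(\<forall>y. g y \<le> c) \<longleftrightarrow> \<alpha> \<le> c" for c
    using g unfolding realizes_def by blast
  \<comment> \<open>When \<open>y\<close> is an atom, the second conjunct of the relation holds
    automatically.\<close>
  have g_in: "y \<in> atoms \<Longrightarrow> z \<le> CA y \<Longrightarrow> g z \<le> CB (g y)" and g_out: "\<not> z \<le> CA y \<Longrightarrow> g z \<sqinter> CB (g y) = \<bottom>" for y z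
    using g unfolding realizes_def by metis+
  define f where "f x = finjoin g {w \<in> atoms. w \<le> x}" for x
  have f_le: "f x \<le> c \<longleftrightarrow> (\<forall>w\<in>atoms. w \<le> x \<longrightarrow> g w \<le> c)" for x c
    unfolding f_def using finS by (auto simp: finjoin_le_iff)
  have f_le_\<alpha>: "f x \<le> \<alpha>" for x
    using g_lub[of \<alpha>] by (simp add: f_le)
  have f_upper: "w \<in> atoms \<Longrightarrow> w \<le> x \<Longrightarrow> g w \<le> f x" for w x
    using f_le[of x "f x"] by simp
  have f_disj: "f x \<sqinter> c = \<bottom> \<longleftrightarrow> (\<forall>w\<in>atoms. w \<le> x \<longrightarrow> g w \<sqinter> c = \<bottom>)" for x c
    unfolding f_def using finS by (auto simp: disjoint_finjoin_iff)
  have f_sup: "f (x \<squnion> y) = f x \<squnion> f y" for x y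
  proof -
    have "{w \<in> atoms. w \<le> x \<squnion> y} = {w \<in> atoms. w \<le> x} \<union> {w \<in> atoms. w \<le> y}"
      by (auto simp: atom_le_sup_iff)
    then show ?thesis
      unfolding f_def using finS by (simp add: finjoin_Un)
  qed
  have f_top: "f \<top> = \<alpha>"
  proof (rule order.antisym)
    have "g y \<le> f \<top>" for y
      using f_upper[of y \<top>] g_nz[of y] by (cases "y \<in> atoms") auto
    then show "\<alpha> \<le> f \<top>" using g_lub by blast
  qed (rule f_le_\<alpha>)
  have f_bot: "f \<bottom> = \<bottom>"
    using f_le[of \<bottom> \<bottom>] by (auto simp: bot_unique atoms_def)
  have f_eq_botD: "x = \<bottom>" if "f x = \<bottom>" for x
  proof (rule ccontr)
    assume "x \<noteq> \<bottom>"
    then obtain w where "w \<in> atoms" "w \<le> x" using ex_atom_le[OF fin] by blast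
    then show False using f_upper g_nz that by (metis bot_unique)
  qed
  have f_disjoint: "f x \<sqinter> f y = \<bottom>" if "x \<sqinter> y = \<bottom>" for x y
  proof -
    have "g v \<sqinter> g w = \<bottom>" if "w \<in> atoms" "w \<le> x" "v \<in> atoms" "v \<le> y" for w v
    proof (rule g_disj)
      show "v \<noteq> w"
      proof
        assume "v = w"
        then have "w \<le> x \<sqinter> y" using that by simp
        then show False using \<open>x \<sqinter> y = \<bottom>\<close> \<open>w \<in> atoms\<close> by (simp add: atoms_def bot_unique)
      qed
    qed
    then have "g w \<sqinter> f y = \<bottom>" if "w \<in> atoms" "w \<le> x" for w
      using that f_disj[of y "g w"] inf_commute[of "g w"] by simp
    then show ?thesis
      using f_disj by blast
  qed
  have f_compl: "f (- x) = \<alpha> \<sqinter> - f x" for x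
  proof (rule order.antisym)
    show "f (- x) \<le> \<alpha> \<sqinter> - f x"
      using f_disjoint[of "- x" x] f_le_\<alpha> by (simp add: inf_shunt)
    have "\<alpha> = f (- x) \<squnion> f x"
      using f_sup[of "- x" x] f_top by simp
    then show "\<alpha> \<sqinter> - f x \<le> f (- x)"
      by (simp add: inf_sup_distrib2)
  qed
  have f_inf: "f (x \<sqinter> y) = f x \<sqinter> f y" for x y
  proof -
    have "f (x \<sqinter> y) = f (- (- x \<squnion> - y))" by simp
    also have "\<dots> = \<alpha> \<sqinter> - ((\<alpha> \<sqinter> - f x) \<squnion> (\<alpha> \<sqinter> - f y))"
      by (simp only: f_compl f_sup)
    also have "\<dots> = (\<alpha> \<sqinter> f x) \<sqinter> (\<alpha> \<sqinter> f y)"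
      by (simp add: inf_sup_distrib1 inf_sup_distrib2 ac_simps)
    also have "\<dots> = f x \<sqinter> f y"
      using f_le_\<alpha> by (simp add: inf.absorb2)
    finally show ?thesis .
  qed
  have "inj f"
  proof (rule injI)
    fix x y assume eq: "f x = f y"
    \<comment> \<open>Injectivity reduces to the trivial kernel \<open>f_eq_botD\<close>, applied to
      the difference of \<open>x\<close> and \<open>y\<close>.\<close>
    have "x \<le> y" if "f x = f y" for x y
    proof -
      have "f (x \<sqinter> - y) = \<bottom>"
        using that by (simp add: f_inf f_compl inf_left_commute[of _ \<alpha>])
      then have "x \<sqinter> - y = \<bottom>" by (rule f_eq_botD)
      then show ?thesis by (simp add: inf_shunt)
    qed
    then show "x = y" using eq by (metis order.antisym)
  qed
  moreover have "boolean_hom_rel f \<alpha>"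
    unfolding boolean_hom_rel_def rel_carrier_def rel_compl_def
    using f_le_\<alpha> f_sup f_inf f_compl f_bot f_top by auto
  moreover have "f (CA x) = \<alpha> \<sqinter> CB (f x)" for x
  proof -
    let ?S = "{w \<in> atoms. w \<le> x}"
    have CA_x: "CA x = finjoin CA ?S"
      using closure_finjoin[OF CA finS[of ?S], of "\<lambda>w. w"] finjoin_atoms_le[OF fin, of x] by simp
    have below: "w \<le> CA x \<longleftrightarrow> (\<exists>v\<in>?S. w \<le> CA v)" if "w \<in> atoms" for w
      unfolding CA_x using that finS by (rule atom_le_finjoin_iff)
    have CB_fx: "CB (f x) = finjoin (\<lambda>w. CB (g w)) ?S"
      unfolding f_def by (rule closure_finjoin[OF CB finS])
    have "f (CA x) \<le> CB (f x)"
      unfolding f_le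
    proof (intro ballI impI)
      fix w assume "w \<in> atoms" "w \<le> CA x"
      then obtain v where v: "v \<in> ?S" "w \<le> CA v" using below by blast
      then have "g w \<le> CB (g v)" using g_in by simp
      also have "\<dots> \<le> CB (f x)" using closure_mono[OF CB] f_upper v by blast
      finally show "g w \<le> CB (f x)" .
    qed
    \<comment> \<open>An upper bound for \<open>CB (f x)\<close> cannot be tested on pieces
      directly, but disjointness from the image of the complement can be checked atom by
      atom.\<close>
    moreover have "f (- CA x) \<sqinter> CB (f x) = \<bottom>"
      unfolding f_disj
    proof (intro ballI impI)
      fix w :: 'a assume w: "w \<in> atoms" "w \<le> - CA x"
      then have "\<forall>v\<in>?S. \<not> w \<le> CA v" using below atom_le_compl_iff by blast
      then show "g w \<sqinter> CB (f x) = \<bottom>"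
        unfolding CB_fx using g_out disjoint_finjoin_iff'[OF finS] by blast
    qed
    then have "\<alpha> \<sqinter> CB (f x) \<le> f (CA x)"
      unfolding f_compl by (metis inf.assoc inf.commute inf_shunt double_compl)
    ultimately show ?thesis
      using f_le_\<alpha> by (simp add: order.antisym)
  qed
  ultimately show ?thesis by blast
qed

section \<open>Tangled closure as a greatest post-fixed point\<close>

lemma tangled_closure_fix:
  assumes "tangled_closure_algebra Ct" and "finite \<Gamma>" and "\<gamma> \<in> \<Gamma>"
  shows "Ct \<Gamma> \<le> induced_closure Ct (\<gamma> \<sqinter> Ct \<Gamma>)"
proof -
  have "Ct \<Gamma> \<le> Inf_fin ((\<lambda>\<gamma>. induced_closure Ct (\<gamma> \<sqinter> Ct \<Gamma>)) ` \<Gamma>)"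
    using assms unfolding tangled_closure_algebra_def by blast
  also have "\<dots> \<le> induced_closure Ct (\<gamma> \<sqinter> Ct \<Gamma>)"
    using assms by (intro Inf_fin.coboundedI) auto
  finally show ?thesis .
qed

text \<open>For a post-fixed point \<open>a\<close> the implication in (Ind) is
  \<open>\<top>\<close>, and so is its interior.\<close>

lemma tangled_closure_greatest:
  assumes T: "tangled_closure_algebra Ct" and "finite \<Gamma>" and "\<Gamma> \<noteq> {}"
    and le: "\<And>\<gamma>. \<gamma> \<in> \<Gamma> \<Longrightarrow> a \<le> induced_closure Ct (\<gamma> \<sqinter> a)"
  shows "a \<le> Ct \<Gamma>"
proof -
  let ?m = "Inf_fin ((\<lambda>\<gamma>. induced_closure Ct (\<gamma> \<sqinter> a)) ` \<Gamma>)"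
  have "a \<le> ?m"
    using assms by (intro Inf_fin.boundedI) auto
  then have "bimp a ?m = \<top>"
    unfolding bimp_def by (metis shunt1 inf_top_left top_unique sup_commute)
  moreover have "interior_op (induced_closure Ct) \<top> = \<top>"
    using T by (simp add: tangled_closure_algebra_def closure_operator_def interior_op_def)
  moreover have "interior_op (induced_closure Ct) (bimp a ?m) \<sqinter> a \<le> Ct \<Gamma>"
    using assms unfolding tangled_closure_algebra_def by blast
  ultimately show ?thesis by simp
qed

lemma closure_embedding_preserves_tangle:
  fixes CtA :: "'a::boolean_algebra set \<Rightarrow> 'a" and CtB :: "'b::boolean_algebra set \<Rightarrow> 'b"
  assumes TA: "tangled_closure_algebra CtA" and TB: "tangled_closure_algebra CtB"
    and fin: "finite (UNIV :: 'a set)"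
    and hom: "boolean_hom_rel f \<alpha>"
    and cl: "\<And>x. f (induced_closure CtA x) = \<alpha> \<sqinter> induced_closure CtB (f x)"
    and \<Gamma>: "finite \<Gamma>" "\<Gamma> \<noteq> {}"
  shows "f (CtA \<Gamma>) = \<alpha> \<sqinter> CtB (f ` \<Gamma>)"
proof (rule order.antisym)
  have f_inf: "f (x \<sqinter> y) = f x \<sqinter> f y" and f_top: "f \<top> = \<alpha>" and f_le: "f x \<le> \<alpha>" for x y
    using hom unfolding boolean_hom_rel_def rel_carrier_def by auto
  have f_mono: "x \<le> y \<Longrightarrow> f x \<le> f y" for x y
    by (metis f_inf inf.orderE inf_le2)
  have CB: "closure_operator (induced_closure CtB)"
    using TB by (simp add: tangled_closure_algebra_def)
  \<comment> \<open>Applying \<open>f\<close> to (Fix) in \<open>A\<close> makes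
    \<open>f (CtA \<Gamma>)\<close> a post-fixed point in \<open>B\<close>.\<close>
  have "f (CtA \<Gamma>) \<le> CtB (f ` \<Gamma>)"
  proof (rule tangled_closure_greatest[OF TB])
    fix d assume "d \<in> f ` \<Gamma>"
    then obtain \<gamma> where \<gamma>: "\<gamma> \<in> \<Gamma>" "d = f \<gamma>" by blast
    show "f (CtA \<Gamma>) \<le> induced_closure CtB (d \<sqinter> f (CtA \<Gamma>))"
      using f_mono[OF tangled_closure_fix[OF TA \<Gamma>(1) \<gamma>(1)]] \<gamma>(2) by (simp add: cl f_inf)
  qed (use \<Gamma> in auto)
  then show "f (CtA \<Gamma>) \<le> \<alpha> \<sqinter> CtB (f ` \<Gamma>)"
    using f_le by simp
  define b where "b = \<alpha> \<sqinter> CtB (f ` \<Gamma>)"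
  have finS: "finite S" for S :: "'a set" by (rule finite_subset[OF subset_UNIV fin])
  \<comment> \<open>This is the left adjoint of \<open>f\<close> at \<open>b\<close>; it exists
    because \<open>f\<close> preserves the meets of the finite algebra \<open>A\<close>.\<close>
  define a where "a = Inf_fin {x. b \<le> f x}"
  have ne: "\<top> \<in> {x. b \<le> f x}"
    by (simp add: f_top b_def)
  have a_le: "a \<le> x" if "b \<le> f x" for x
    unfolding a_def using that finS by (intro Inf_fin.coboundedI) auto
  have b_le: "b \<le> f a"
  proof -
    have le_f: "b \<le> f (Inf_fin S)" if "finite S" "S \<noteq> {}" "\<forall>x\<in>S. b \<le> f x" for S
      using that by (induction S rule: finite_ne_induct) (simp_all add: f_inf)
    show ?thesis
      unfolding a_def
    proof (rule le_f)
      show "{x. b \<le> f x} \<noteq> {}" using ne by force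
    qed (simp_all add: finS)
  qed
  have "a \<le> CtA \<Gamma>"
  proof (rule tangled_closure_greatest[OF TA \<Gamma>])
    fix \<gamma> assume "\<gamma> \<in> \<Gamma>"
    have post: "b \<le> induced_closure CtB (f \<gamma> \<sqinter> CtB (f ` \<Gamma>))"
      using tangled_closure_fix[OF TB, of "f ` \<Gamma>" "f \<gamma>"] \<Gamma>(1) \<open>\<gamma> \<in> \<Gamma>\<close> by (auto simp: b_def intro: le_infI2)
    \<comment> \<open>Relativisation is harmless here because \<open>f \<gamma>\<close> is already
      below \<open>\<alpha>\<close>.\<close>
    have "f \<gamma> \<sqinter> CtB (f ` \<Gamma>) = f \<gamma> \<sqinter> b"
      using f_le[of \<gamma>] by (simp add: b_def inf.absorb1 flip: inf_assoc)
    also have "\<dots> \<le> f (\<gamma> \<sqinter> a)"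
      using b_le by (simp add: f_inf le_infI2)
    finally have "b \<le> induced_closure CtB (f (\<gamma> \<sqinter> a))"
      using post closure_mono[OF CB] by (metis order.trans)
    then have "b \<le> f (induced_closure CtA (\<gamma> \<sqinter> a))"
      by (simp add: cl b_def)
    then show "a \<le> induced_closure CtA (\<gamma> \<sqinter> a)"
      by (rule a_le)
  qed
  then show "\<alpha> \<sqinter> CtB (f ` \<Gamma>) \<le> f (CtA \<Gamma>)"
    using order.trans[OF b_le f_mono] unfolding b_def by blast
qed

theorem theorem4p3:
  fixes CtB :: "'b::boolean_algebra set \<Rightarrow> 'b"
    and \<alpha> :: 'b
    and CtA :: "'a::boolean_algebra set \<Rightarrow> 'a"
  assumes "tangled_closure_algebra CtB"
    and "totally_disconnected (induced_closure CtB)"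
    and "dissectable (induced_closure CtB)"
    and "open_element (induced_closure CtB) \<alpha>"
    and "\<alpha> \<noteq> \<bottom>"
    and "tangled_closure_algebra CtA"
    and "finite (UNIV :: 'a set)"
    and "(\<bottom> :: 'a) \<noteq> \<top>"
  shows "\<exists>f :: 'a \<Rightarrow> 'b. boolean_hom_rel f \<alpha> \<and> inj f \<and>
           (\<forall>\<Gamma>. finite \<Gamma> \<and> \<Gamma> \<noteq> {} \<longrightarrow> f (CtA \<Gamma>) = rel_tangle \<alpha> CtB (f ` \<Gamma>))"
proof -
  have CB: "closure_operator (induced_closure CtB)" and CA: "closure_operator (induced_closure CtA)"
    using assms(1,6) by (simp_all add: tangled_closure_algebra_def)
  \<comment> \<open>The second conjunct makes the atoms an up-set of a preorder on the whole type.\<close>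
  let ?R = "\<lambda>w v :: 'a. w \<le> induced_closure CtA v \<and> (w \<in> atoms \<longrightarrow> v \<in> atoms)"
  have "\<exists>g. realizes (induced_closure CtB) ?R atoms \<alpha> g"
  proof (rule realizes_finite_preorder[OF CB assms(2,3)])
    show "?R x x" for x
      using closure_increasing[OF CA] by simp
    show "?R x z" if "?R x y" "?R y z" for x y z
      using that closure_mono[OF CA, of y] closure_idem[OF CA, of z] by (metis order.trans)
    show "finite (atoms :: 'a set)"
      by (rule finite_subset[OF subset_UNIV assms(7)])
    \<comment> \<open>Non-triviality of \<open>A\<close> enters here: it provides an atom below
      \<open>\<top>\<close>.\<close>
    show "(atoms :: 'a set) \<noteq> {}"
      using ex_atom_le[OF assms(7), of \<top>] assms(8) by (metis empty_iff)
  qed (use assms(4,5) in auto)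
  then obtain f where f: "boolean_hom_rel f \<alpha>" "inj f"
    "\<And>x. f (induced_closure CtA x) = \<alpha> \<sqinter> induced_closure CtB (f x)"
    using closure_embedding_of_realization[OF CA CB assms(7)] by blast
  then have "\<forall>\<Gamma>. finite \<Gamma> \<and> \<Gamma> \<noteq> {} \<longrightarrow> f (CtA \<Gamma>) = rel_tangle \<alpha> CtB (f ` \<Gamma>)"
    using closure_embedding_preserves_tangle[OF assms(6,1,7) f(1) f(3)]
    by (simp add: rel_tangle_def)
  then show ?thesis
    using f(1,2) by blast
qed

end
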